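(* Let $n\ge 1$, let $\chi:\mathbb{R}^n\to\mathbb{R}$ be a kernel, with $\mu>0$ and $\beta>0$ the constants in the kernel conditions $(\chi 2)$ and $(\chi 3)$ respectively, and let $f\in Lip_\infty(\nu)$ with $0<\nu\le 1$. Then $$\|S_wf-f\|_\infty=\mathcal{O}(w^{-\epsilon})\quad\text{as } w\to+\infty,\qquad \epsilon:=\min\{\nu,\beta,\mu\}.$$
   Context: **Sampling nodes.** $\Pi^n=(t_{\underline{k}})_{\underline{k}\in\mathbb{Z}^n}$ with $t_{\underline{k}}=(t_{k_1},\dots,t_{k_n})$, where for each $i=1,\dots,n$, $(t_{k_i})_{k_i\in\mathbb{Z}}$ is a sequence of real numbers with $t_{k_i}<t_{k_i+1}$ for all $k_i$, $\lim_{k_i\to\pm\infty}t_{k_i}=\pm\infty$, and there are constants $\Delta,\delta>0$ with $\delta\le\Delta_{k_i}:=t_{k_i+1}-t_{k_i}\le\Delta$ for every $k_i\in\mathbb{Z}$ and every $i$ (the sequence may depend on $i$). **Kernel.** A function $\chi:\mathbb{R}^n\to\mathbb{R}$ is called a kernel if: - $(\chi 1)$ $\chi\in L^1(\mathbb{R}^n)$ and $\chi$ is bounded in a neighborhood of the origin; - $(\chi 2)$ for some $\mu>0$, $A_w(\underline{x})-1=\mathcal{O}(w^{-\mu})$ as $w\to+\infty$, uniformly in $\underline{x}\in\mathbb{R}^n$, where $A_w(\underline{x}):=\sum_{\underline{k}\in\mathbb{Z}^n}\chi(w\underline{x}-t_{\underline{k}})$; - $(\chi 3)$ for some $\beta>0$,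 $m_{\beta,\Pi^n}(\chi):=\sup_{\underline{u}\in\mathbb{R}^n}\sum_{\underline{k}\in\mathbb{Z}^n}|\chi(\underline{u}-t_{\underline{k}})|\,\|\underline{u}-t_{\underline{k}}\|_2^\beta<+\infty$; - $(\chi 4)$ there exists $\alpha>0$ such that, for every $M>0$, $\int_{\|\underline{u}\|_2>M}w^n|\chi(w\underline{u})|\,d\underline{u}=\mathcal{O}(w^{-\alpha})$ as $w\to+\infty$. Here $\|\cdot\|_2$ is the Euclidean norm. **Operators.** For $w>0$, $R^w_{\underline{k}}:=\prod_{i=1}^n[t_{k_i}/w,\,t_{k_i+1}/w]$, $A_{\underline{k}}:=\Delta_{k_1}\cdots\Delta_{k_n}$, and the multivariate sampling Kantorovich operator is $$(S_wf)(\underline{x}):=\sum_{\underline{k}\in\mathbb{Z}^n}\chi(w\underline{x}-t_{\underline{k}})\left[\frac{w^n}{A_{\underline{k}}}\int_{R^w_{\underline{k}}}f(\underline{u})\,d\underline{u}\right],\qquad \underline{x}\in\mathbb{R}^n,$$ for locally integrable $f:\mathbb{R}^n\to\mathbb{R}$ such that the series converges for every $\underline{x}$. **Lipschitz class.** $C(\mathbb{R}^n)$ is the set of uniformly continuous and bounded functions $f:\mathbb{R}^n\to\mathbb{R}$ with the sup-norm $\|\cdot\|_\infty$. For $0<\nu\le1$, $Lip_\infty(\nu)$ is the set of $f\in C(\mathbb{R}^n)$ for which there exist constants $C,\gamma>0$ such that $\|f(\cdot)-f(\cdot+\underline{t})\|_\infty\le C\|\underline{t}\|_2^\nu$ for all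 $\underline{t}\in\mathbb{R}^n$ with $\|\underline{t}\|_2\le\gamma$. *)

theory Defs
  imports "HOL-Analysis.Analysis" "HOL-Library.Landau_Symbols"
begin

text \<open>
  The dimension \<open>n \<ge> 1\<close> is the cardinality of the index type \<open>'n\<close>. The nodes are given by one
  sequence per coordinate, \<open>t :: 'n \<Rightarrow> int \<Rightarrow> real\<close>; multi-indices have type \<open>int ^ 'n\<close>. The kernel
  is written \<open>chi\<close>, because the corresponding Greek letter is the binder of vectors.
\<close>

definition sampling_nodes :: "('n::finite \<Rightarrow> int \<Rightarrow> real) \<Rightarrow> bool" where
  "sampling_nodes t \<longleftrightarrow>
     (\<forall>i. (\<forall>j. t i j < t i (j + 1)) \<and>
          filterlim (t i) at_top at_top \<and> filterlim (t i) at_bot at_bot) \<and>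
     (\<exists>\<delta>>0. \<exists>\<Delta>>0. \<forall>i j. \<delta> \<le> t i (j + 1) - t i j \<and> t i (j + 1) - t i j \<le> \<Delta>)"

definition node :: "('n::finite \<Rightarrow> int \<Rightarrow> real) \<Rightarrow> int ^ 'n \<Rightarrow> real ^ 'n" where
  "node t k = (\<chi> i. t i (k $ i))"

text \<open>
  The supremum norm takes values in the extended non-negative reals, hence it is meaningful (and
  equal to \<open>\<infinity>\<close>) also for unbounded functions.
\<close>

definition sup_norm :: "('a \<Rightarrow> real) \<Rightarrow> ennreal" where
  "sup_norm g = (SUP x. ennreal \<bar>g x\<bar>)"

text \<open>
  The Landau condition \<open>\<parallel>g\<^sub>w\<parallel>\<^sub>\<infinity> = O(h(w))\<close> as \<open>w \<rightarrow> +\<infinity>\<close>, that is, \<open>g\<^sub>w(x) = O(h(w))\<close> uniformly in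
  \<open>x\<close>. The library relation \<open>bigo\<close> is not available for values in \<open>ennreal\<close>.
\<close>

definition sup_norm_bigo :: "(real \<Rightarrow> 'a \<Rightarrow> real) \<Rightarrow> (real \<Rightarrow> real) \<Rightarrow> bool" where
  "sup_norm_bigo g h \<longleftrightarrow>
     (\<exists>C>0. \<forall>\<^sub>F w in at_top. sup_norm (g w) \<le> ennreal (C * \<bar>h w\<bar>))"

definition discrete_sum ::
  "('n::finite \<Rightarrow> int \<Rightarrow> real) \<Rightarrow> (real ^ 'n \<Rightarrow> real) \<Rightarrow> real \<Rightarrow> real ^ 'n \<Rightarrow> real" where
  "discrete_sum t chi w x = (\<Sum>\<^sub>\<infinity>k. chi (w *\<^sub>R x - node t k))"

definition discrete_moment ::
  "('n::finite \<Rightarrow> int \<Rightarrow> real) \<Rightarrow> real \<Rightarrow> (real ^ 'n \<Rightarrow> real) \<Rightarrow> ennreal" where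
  "discrete_moment t \<beta> chi =
     (SUP u. \<Sum>\<^sub>\<infinity>k. ennreal (\<bar>chi (u - node t k)\<bar> * norm (u - node t k) powr \<beta>))"

text \<open>
  The constants \<open>\<mu>\<close> and \<open>\<beta>\<close> are parameters since the order of approximation depends on them.
  Unconditional convergence of the series in \<open>discrete_sum\<close> is a consequence of boundedness near
  the origin together with finiteness of the moment.
\<close>

definition sampling_kernel ::
  "('n::finite \<Rightarrow> int \<Rightarrow> real) \<Rightarrow> real \<Rightarrow> real \<Rightarrow> (real ^ 'n \<Rightarrow> real) \<Rightarrow> bool" where
  "sampling_kernel t \<mu> \<beta> chi \<longleftrightarrow>
     integrable lebesgue chi \<and> (\<exists>U. open U \<and> 0 \<in> U \<and> bounded (chi ` U)) \<and>
     \<mu> > 0 \<and> sup_norm_bigo (\<lambda>w x. discrete_sum t chi w x - 1) (\<lambda>w. w powr - \<mu>) \<and>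
     \<beta> > 0 \<and> discrete_moment t \<beta> chi < \<infinity> \<and>
     (\<exists>\<alpha>>0. \<forall>M>0.
        (\<lambda>w. LINT u:{u. norm u > M}|lebesgue. w ^ CARD('n) * \<bar>chi (w *\<^sub>R u)\<bar>)
          \<in> O[at_top](\<lambda>w. w powr - \<alpha>))"

definition node_box :: "('n::finite \<Rightarrow> int \<Rightarrow> real) \<Rightarrow> real \<Rightarrow> int ^ 'n \<Rightarrow> (real ^ 'n) set" where
  "node_box t w k = {u. \<forall>i. u $ i \<in> {t i (k $ i) / w .. t i (k $ i + 1) / w}}"

definition node_volume :: "('n::finite \<Rightarrow> int \<Rightarrow> real) \<Rightarrow> int ^ 'n \<Rightarrow> real" where
  "node_volume t k = (\<Prod>i\<in>UNIV. t i (k $ i + 1) - t i (k $ i))"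

definition kantorovich_term ::
  "('n::finite \<Rightarrow> int \<Rightarrow> real) \<Rightarrow> (real ^ 'n \<Rightarrow> real) \<Rightarrow> real \<Rightarrow> (real ^ 'n \<Rightarrow> real) \<Rightarrow>
     real ^ 'n \<Rightarrow> int ^ 'n \<Rightarrow> real" where
  "kantorovich_term t chi w f x k =
     chi (w *\<^sub>R x - node t k) *
       (w ^ CARD('n) / node_volume t k * (LINT u:node_box t w k|lebesgue. f u))"

definition kantorovich ::
  "('n::finite \<Rightarrow> int \<Rightarrow> real) \<Rightarrow> (real ^ 'n \<Rightarrow> real) \<Rightarrow> real \<Rightarrow> (real ^ 'n \<Rightarrow> real) \<Rightarrow>
     real ^ 'n \<Rightarrow> real" where
  "kantorovich t chi w f x = (\<Sum>\<^sub>\<infinity>k. kantorovich_term t chi w f x k)"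

text \<open>
  Membership in the domain of the operator; outside of it, \<open>kantorovich\<close> has the default values of
  the integral and of \<open>infsum\<close>.
\<close>

definition kantorovich_defined ::
  "('n::finite \<Rightarrow> int \<Rightarrow> real) \<Rightarrow> (real ^ 'n \<Rightarrow> real) \<Rightarrow> real \<Rightarrow> (real ^ 'n \<Rightarrow> real) \<Rightarrow> bool" where
  "kantorovich_defined t chi w f \<longleftrightarrow>
     (\<forall>S. compact S \<longrightarrow> set_integrable lebesgue S f) \<and>
     (\<forall>x. kantorovich_term t chi w f x summable_on UNIV)"

definition Lip_infinity :: "real \<Rightarrow> (real ^ 'n::finite \<Rightarrow> real) set" where
  "Lip_infinity \<nu> =
     {f. uniformly_continuous_on UNIV f \<and> bounded (range f) \<and>
         (\<exists>C>0. \<exists>\<gamma>>0. \<forall>h. norm h \<le> \<gamma> \<longrightarrow>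
            sup_norm (\<lambda>x. f x - f (x + h)) \<le> ennreal (C * norm h powr \<nu>))}"

end

theory Submission imports Defs
begin

text \<open>
  Put \<open>e = min \<nu> \<beta>\<close>. A point of the cell of \<open>k\<close> is at distance at most \<open>(n\<Delta> + v) / w\<close> from \<open>x\<close>, where
  \<open>v = \<parallel>w x - t\<^sub>k\<parallel>\<close>. As \<open>f\<close> is globally \<open>e\<close>-Hoelder, its mean value over the cell differs from
  \<open>f x\<close> by at most a multiple of \<open>w powr -e * (1 + v powr \<beta>)\<close>. The nodes are separated, so a ball
  contains a bounded number of them; hence \<open>\<Sum>\<^sub>k |chi (w x - t\<^sub>k)| * (1 + v powr \<beta>)\<close> is bounded
  uniformly in \<open>w\<close> and \<open>x\<close>, and the terms near the origin, which the moment does not control, cause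
  no harm. What remains is \<open>f x\<close> times \<open>A\<^sub>w x - 1\<close>, which is of order \<open>w powr -\<mu>\<close>.
\<close>

section \<open>Counting the nodes in a ball\<close>

lemma node_gap:
  fixes s :: "int \<Rightarrow> real"
  assumes "\<And>j. \<delta> \<le> s (j + 1) - s j" "i \<le> j"
  shows "\<delta> * (j - i) \<le> s j - s i"
  using assms(2)
proof (induction j rule: int_ge_induct)
  case (step j)
  then show ?case using assms(1)[of j] by (simp add: algebra_simps)
qed simp

lemma card_int_vec_box:
  fixes c :: "int ^ 'n::finite" and N :: nat
  defines "B \<equiv> {k :: int ^ 'n. \<forall>i. k $ i \<in> {c $ i - N .. c $ i + N}}"
  shows "finite B" and "card B \<le> (2 * N + 1) ^ CARD('n)"
proof -
  let ?P = "Pi\<^sub>E (UNIV :: 'n set) (\<lambda>i. {c $ i - N .. c $ i + N})"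
  have fin: "finite ?P" by (intro finite_PiE) auto
  have sub: "B \<subseteq> vec_lambda ` ?P"
  proof
    fix k assume "k \<in> B"
    then have "vec_nth k \<in> ?P" by (auto simp: B_def PiE_def)
    then show "k \<in> vec_lambda ` ?P" by (metis image_eqI vec_nth_inverse)
  qed
  show "finite B" using fin sub by (meson finite_imageI finite_subset)
  have "card B \<le> card ?P"
    using fin sub by (meson card_image_le card_mono finite_imageI le_trans)
  also have "\<dots> = (2 * N + 1) ^ CARD('n)" by (simp add: card_PiE nat_add_distrib nat_mult_distrib)
  finally show "card B \<le> (2 * N + 1) ^ CARD('n)" .
qed

text \<open>Indices of two nodes in the same ball differ by at most \<open>2 * r / \<delta>\<close>
  in every coordinate, so all of them lie in one index box whose size does not depend on
  \<open>u\<close>.\<close>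

lemma card_nodes_in_ball:
  fixes t :: "'n::finite \<Rightarrow> int \<Rightarrow> real"
  assumes "sampling_nodes t"
  obtains N :: nat where
    "\<And>u. finite {k. norm (u - node t k) < r}" "\<And>u. card {k. norm (u - node t k) < r} \<le> N"
proof -
  obtain \<delta> where \<delta>: "\<delta> > 0" "\<And>i j. \<delta> \<le> t i (j + 1) - t i j"
    using assms unfolding sampling_nodes_def by blast
  \<comment> \<open>This \<open>N\<close> is the half-width of the index box; the bound delivered at
    the end is \<open>(2 * N + 1) ^ CARD('n)\<close>.\<close>
  define N where "N = nat \<lceil>2 * r / \<delta>\<rceil>"
  have ex: "\<exists>c :: int ^ 'n. {k. norm (u - node t k) < r} \<subseteq> {k. \<forall>i. k $ i \<in> {c $ i - N .. c $ i + N}}" for u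
  proof (cases "{k. norm (u - node t k) < r} = {}")
    case False
    then obtain c where c: "norm (u - node t c) < r" by blast
    have "k $ i \<in> {c $ i - N .. c $ i + N}" if k: "norm (u - node t k) < r" for k i
    proof -
      have "\<bar>u $ i - t i (k $ i)\<bar> < r" "\<bar>u $ i - t i (c $ i)\<bar> < r"
        using component_le_norm_cart[of "u - node t k" i] component_le_norm_cart[of "u - node t c" i] k c
        by (auto simp: node_def)
      moreover have "\<delta> * \<bar>k $ i - c $ i\<bar> \<le> \<bar>t i (k $ i) - t i (c $ i)\<bar>"
        using node_gap[of \<delta> "t i" "k $ i" "c $ i"] node_gap[of \<delta> "t i" "c $ i" "k $ i"] \<delta>(2)
        by (cases "k $ i \<le> c $ i") auto
      ultimately have "\<delta> * \<bar>k $ i - c $ i\<bar> \<le> 2 * r" by linarith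
      then have "\<bar>k $ i - c $ i\<bar> \<le> 2 * r / \<delta>" using \<delta>(1) by (simp add: field_simps)
      then have "\<bar>k $ i - c $ i\<bar> \<le> \<lceil>2 * r / \<delta>\<rceil>" by linarith
      then have "\<bar>k $ i - c $ i\<bar> \<le> int N" unfolding N_def by linarith
      then show ?thesis by auto
    qed
    then show ?thesis by blast
  qed auto
  show thesis
  proof
    fix u
    obtain c :: "int ^ 'n" where "{k. norm (u - node t k) < r} \<subseteq> {k. \<forall>i. k $ i \<in> {c $ i - N .. c $ i + N}}"
      using ex by blast
    then show "finite {k. norm (u - node t k) < r}"
      and "card {k. norm (u - node t k) < r} \<le> (2 * N + 1) ^ CARD('n)"
      using card_int_vec_box[of c N] by (meson finite_subset card_mono le_trans)+
  qed
qed

section \<open>Uniform bounds for kernel sums\<close>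

text \<open>Within distance \<open>r\<close> of the origin the kernel is bounded and boundedly many
  nodes contribute; farther out \<open>(norm v / r) powr \<beta>\<close> is at least 1, so the
  moment dominates. Working with finite sums avoids any prior claim of summability.\<close>

lemma kernel_weighted_sum_bounded:
  fixes t :: "'n::finite \<Rightarrow> int \<Rightarrow> real" and chi :: "real ^ 'n \<Rightarrow> real"
  assumes "sampling_nodes t" "sampling_kernel t \<mu> \<beta> chi"
  obtains c where "c \<ge> 0"
    "\<And>u F. finite F \<Longrightarrow> (\<Sum>k\<in>F. \<bar>chi (u - node t k)\<bar> * (1 + norm (u - node t k) powr \<beta>)) \<le> c"
proof -
  obtain U where U: "open U" "0 \<in> U" "bounded (chi ` U)" and "\<beta> > 0"
    and mom: "discrete_moment t \<beta> chi < \<infinity>"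
    using assms(2) unfolding sampling_kernel_def by blast
  obtain r where r: "r > 0" "ball 0 r \<subseteq> U" using U openE by blast
  obtain B where B: "B > 0" "\<And>v. v \<in> U \<Longrightarrow> \<bar>chi v\<bar> \<le> B"
    using U(3) unfolding bounded_pos by auto
  obtain N where fin: "\<And>u. finite {k. norm (u - node t k) < r}"
    and N: "\<And>u. card {k. norm (u - node t k) < r} \<le> N"
    using card_nodes_in_ball[OF assms(1)] by blast
  \<comment> \<open>The moment is finite, so \<open>ennreal m\<close> recovers it.\<close>
  define m where "m = enn2real (discrete_moment t \<beta> chi)"
  have m: "(\<Sum>k\<in>F. \<bar>chi (u - node t k)\<bar> * norm (u - node t k) powr \<beta>) \<le> m" if "finite F" for u F
  proof -
    let ?g = "\<lambda>k. \<bar>chi (u - node t k)\<bar> * norm (u - node t k) powr \<beta>"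
    have "ennreal (sum ?g F) = (\<Sum>k\<in>F. ennreal (?g k))" by (simp add: sum_ennreal)
    also have "\<dots> \<le> (\<Sum>\<^sub>\<infinity>k. ennreal (?g k))"
      using that by (subst nonneg_infsum_complete) (auto intro: SUP_upper)
    also have "\<dots> \<le> discrete_moment t \<beta> chi" unfolding discrete_moment_def by (rule SUP_upper) simp
    also have "\<dots> = ennreal m" using mom by (simp add: m_def)
    finally show ?thesis by (simp add: m_def)
  qed
  have "m \<ge> 0" by (simp add: m_def)
  show thesis
  proof
    \<comment> \<open>\<open>N * B\<close> accounts for the near nodes,
      \<open>m / r powr \<beta>\<close> for the far ones, and the last \<open>m\<close> for the
      weight \<open>norm v powr \<beta>\<close>.\<close>
    show "N * B + (1 / r powr \<beta> + 1) * m \<ge> 0" using \<open>m \<ge> 0\<close> B by simp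
  next
    fix u :: "real ^ 'n" and F :: "(int ^ 'n) set" assume F: "finite F"
    let ?v = "\<lambda>k. u - node t k"
    let ?K = "{k. norm (?v k) < r}"
    have "\<bar>chi (?v k)\<bar> \<le> B * indicator ?K k + 1 / r powr \<beta> * (\<bar>chi (?v k)\<bar> * norm (?v k) powr \<beta>)" for k
    proof (cases "norm (?v k) < r")
      case True
      then have "\<bar>chi (?v k)\<bar> \<le> B" using r by (intro B) auto
      then show ?thesis using True by (simp add: add_increasing2)
    next
      case False
      then have "1 \<le> 1 / r powr \<beta> * norm (?v k) powr \<beta>"
        using r(1) powr_mono2[of \<beta> r "norm (?v k)"] \<open>\<beta> > 0\<close> by (simp add: field_simps)
      then have "\<bar>chi (?v k)\<bar> * 1 \<le> \<bar>chi (?v k)\<bar> * (1 / r powr \<beta> * norm (?v k) powr \<beta>)"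
        by (rule mult_left_mono) simp
      then show ?thesis using False by (simp add: mult_ac)
    qed
    then have "(\<Sum>k\<in>F. \<bar>chi (?v k)\<bar>)
        \<le> (\<Sum>k\<in>F. B * indicator ?K k + 1 / r powr \<beta> * (\<bar>chi (?v k)\<bar> * norm (?v k) powr \<beta>))"
      by (rule sum_mono)
    also have "\<dots> = B * card (F \<inter> ?K) + 1 / r powr \<beta> * (\<Sum>k\<in>F. \<bar>chi (?v k)\<bar> * norm (?v k) powr \<beta>)"
      using F by (simp add: sum.distrib indicator_def sum_of_bool_eq flip: sum_distrib_left sum_divide_distrib)
    also have "\<dots> \<le> B * N + 1 / r powr \<beta> * m"
    proof (intro add_mono mult_left_mono m F)
      have "card (F \<inter> ?K) \<le> card ?K" using fin by (intro card_mono) auto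
      then show "real (card (F \<inter> ?K)) \<le> real N" using N[of u] by simp
    qed (use B in auto)
    finally have "(\<Sum>k\<in>F. \<bar>chi (?v k)\<bar>) \<le> B * N + 1 / r powr \<beta> * m" .
    then show "(\<Sum>k\<in>F. \<bar>chi (?v k)\<bar> * (1 + norm (?v k) powr \<beta>)) \<le> N * B + (1 / r powr \<beta> + 1) * m"
      using m[OF F, of u] by (simp add: algebra_simps sum.distrib)
  qed
qed

text \<open>Comparison with a majorant whose finite sums are bounded. Below, \<open>h\<close> is the
  weighted kernel and the factor \<open>a\<close> carries the decay in \<open>w\<close>.\<close>

lemma abs_summable_on_of_bounded_sums:
  fixes g h :: "'a \<Rightarrow> real"
  assumes "\<And>k. \<bar>g k\<bar> \<le> a * h k" "a \<ge> 0" "\<And>F. finite F \<Longrightarrow> sum h F \<le> c"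
  shows "g summable_on UNIV" and "\<bar>\<Sum>\<^sub>\<infinity>k. g k\<bar> \<le> a * c"
proof -
  have *: "(\<Sum>k\<in>F. \<bar>g k\<bar>) \<le> a * c" if "finite F" for F
  proof -
    have "(\<Sum>k\<in>F. \<bar>g k\<bar>) \<le> a * sum h F"
      unfolding sum_distrib_left by (rule sum_mono) (rule assms(1))
    also have "\<dots> \<le> a * c" using assms that by (intro mult_left_mono) auto
    finally show ?thesis .
  qed
  then have s: "(\<lambda>k. norm (g k)) summable_on UNIV"
    by (intro nonneg_bdd_above_summable_on) (auto intro!: bdd_aboveI2)
  then show "g summable_on UNIV" by (rule abs_summable_summable)
  have "\<bar>\<Sum>\<^sub>\<infinity>k. g k\<bar> \<le> (\<Sum>\<^sub>\<infinity>k. norm (g k))" using norm_infsum_bound[OF s] by simp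
  also have "\<dots> \<le> a * c" using s * by (intro infsum_le_finite_sums) auto
  finally show "\<bar>\<Sum>\<^sub>\<infinity>k. g k\<bar> \<le> a * c" .
qed

section \<open>Supremum norm and Hoelder condition\<close>

lemma sup_norm_le_iff:
  assumes "c \<ge> 0"
  shows "sup_norm g \<le> ennreal c \<longleftrightarrow> (\<forall>x. \<bar>g x\<bar> \<le> c)"
  using assms by (auto simp: sup_norm_def SUP_le_iff)

text \<open>Boundedness of \<open>f\<close> makes the local Hoelder condition global and allows any smaller exponent.\<close>

lemma Lip_infinity_global:
  fixes f :: "real ^ 'n::finite \<Rightarrow> real"
  assumes "f \<in> Lip_infinity \<nu>" "0 < e" "e \<le> \<nu>"
  obtains L where "L \<ge> 0" "\<And>x y. \<bar>f x - f y\<bar> \<le> L * norm (x - y) powr e"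
proof -
  obtain C \<gamma> where C: "C > 0" "\<gamma> > 0" and bdd: "bounded (range f)"
    and H: "\<And>h. norm h \<le> \<gamma> \<Longrightarrow> sup_norm (\<lambda>x. f x - f (x + h)) \<le> ennreal (C * norm h powr \<nu>)"
    using assms(1) unfolding Lip_infinity_def by blast
  obtain M where M: "M > 0" "\<And>x. \<bar>f x\<bar> \<le> M" using bdd unfolding bounded_pos by auto
  \<comment> \<open>Below \<open>\<gamma>\<close> the local estimate applies; below 1, lowering the
    exponent from \<open>\<nu>\<close> to \<open>e\<close> only enlarges the power.\<close>
  define g where "g = min \<gamma> 1"
  have g: "g > 0" "g \<le> \<gamma>" "g \<le> 1" using C by (auto simp: g_def)
  show thesis
  proof
    show "C + 2 * M / g powr e \<ge> 0" using C M by simp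
  next
    fix x y
    show "\<bar>f x - f y\<bar> \<le> (C + 2 * M / g powr e) * norm (x - y) powr e"
    proof (cases "norm (x - y) \<le> g")
      case True
      then have "sup_norm (\<lambda>z. f z - f (z + (y - x))) \<le> ennreal (C * norm (y - x) powr \<nu>)"
        using g by (intro H) (simp add: norm_minus_commute)
      then have "\<bar>f x - f (x + (y - x))\<bar> \<le> C * norm (y - x) powr \<nu>"
        using C by (intro sup_norm_le_iff[THEN iffD1, rule_format]) auto
      also have "\<dots> \<le> C * norm (x - y) powr e"
        using True g assms C by (intro mult_left_mono) (auto simp: norm_minus_commute intro!: powr_mono')
      also have "\<dots> \<le> (C + 2 * M / g powr e) * norm (x - y) powr e"
        using M by (intro mult_right_mono) auto
      finally show ?thesis by simp
    next
      case False
      \<comment> \<open>For distant points the trivial bound \<open>2 * M\<close> suffices, as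
        \<open>norm (x - y) / g\<close> exceeds 1.\<close>
      have "\<bar>f x - f y\<bar> \<le> 2 * M" using M(2)[of x] M(2)[of y] by linarith
      also have "\<dots> \<le> 2 * M / g powr e * norm (x - y) powr e"
        using False g M powr_mono2[of e g "norm (x - y)"] assms by (simp add: field_simps)
      also have "\<dots> \<le> (C + 2 * M / g powr e) * norm (x - y) powr e"
        using C by (intro mult_right_mono) auto
      finally show ?thesis .
    qed
  qed
qed

section \<open>Sampling cells and mean values\<close>

lemma node_box_eq_cbox:
  "node_box t w k = cbox (\<chi> i. t i (k $ i) / w) (\<chi> i. t i (k $ i + 1) / w)"
  by (auto simp: node_box_def mem_box_cart)

lemma node_volume_pos: "sampling_nodes t \<Longrightarrow> node_volume t k > 0"
  unfolding node_volume_def sampling_nodes_def by (auto intro!: prod_pos)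

text \<open>The reciprocal is the normalising factor in \<open>kantorovich_term\<close>, which
  therefore multiplies the kernel by a mean value of \<open>f\<close>.\<close>

lemma measure_node_box:
  fixes t :: "'n::finite \<Rightarrow> int \<Rightarrow> real"
  assumes "sampling_nodes t" "w > 0"
  shows "measure lebesgue (node_box t w k) = node_volume t k / w ^ CARD('n)"
proof -
  have "t i (k $ i) / w \<le> t i (k $ i + 1) / w" for i
    using assms by (auto simp: sampling_nodes_def divide_simps less_imp_le)
  then have "node_box t w k \<noteq> {}" by (auto simp: node_box_eq_cbox interval_ne_empty_cart)
  then show ?thesis
    unfolding node_box_eq_cbox
    by (simp add: content_cbox_cart node_volume_def prod_dividef flip: diff_divide_distrib)
qed

lemma set_integrable_lebesgue_continuous:
  fixes f :: "'a::euclidean_space \<Rightarrow> real"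
  assumes "continuous_on UNIV f" "compact S"
  shows "set_integrable lebesgue S f"
  unfolding set_integrable_def
  using borel_integrable_compact[OF assms(2) continuous_on_subset[OF assms(1)]]
  by (intro integrable_completion[THEN iffD2]) auto

text \<open>The integral lies between those of the constants \<open>a - b\<close> and
  \<open>a + b\<close>; finite positive measure permits the division.\<close>

lemma mean_value_close:
  fixes f :: "'a \<Rightarrow> real"
  assumes "set_integrable M A f" "A \<in> sets M" "emeasure M A < \<infinity>" "measure M A > 0"
    and "\<And>u. u \<in> A \<Longrightarrow> \<bar>f u - a\<bar> \<le> b"
  shows "\<bar>1 / measure M A * (LINT u:A|M. f u) - a\<bar> \<le> b"
proof -
  have c: "set_integrable M A (\<lambda>u. d)" "(LINT u:A|M. d) = d * measure M A" for d :: real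
    using assms by (auto simp: set_integrable_def set_lebesgue_integral_def)
  have "(LINT u:A|M. f u) \<le> (LINT u:A|M. a + b)" "(LINT u:A|M. a - b) \<le> (LINT u:A|M. f u)"
    using assms(5) by (intro set_integral_mono c assms(1); fastforce simp: abs_le_iff)+
  then have "\<bar>(LINT u:A|M. f u) - a * measure M A\<bar> \<le> b * measure M A"
    unfolding c by (auto simp: abs_le_iff algebra_simps)
  moreover have "\<bar>1 / measure M A * (LINT u:A|M. f u) - a\<bar>
      = \<bar>(LINT u:A|M. f u) - a * measure M A\<bar> / measure M A"
    using assms(4) by (simp add: divide_simps abs_if split: if_splits)
  ultimately show ?thesis using assms(4) by (simp add: divide_simps)
qed

text \<open>A sum is at most twice the maximum, which settles all nonnegative exponents at
  once.\<close>

lemma powr_add_le: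
  fixes a b e :: real
  assumes "a \<ge> 0" "b \<ge> 0" "0 \<le> e"
  shows "(a + b) powr e \<le> 2 powr e * (a powr e + b powr e)"
proof -
  have "(a + b) powr e \<le> (2 * max a b) powr e" using assms by (intro powr_mono2) auto
  also have "\<dots> = 2 powr e * max a b powr e" using assms by (simp add: powr_mult)
  also have "\<dots> \<le> 2 powr e * (a powr e + b powr e)" by (intro mult_left_mono) (auto simp: max_def)
  finally show ?thesis .
qed

text \<open>Lets the moment of order \<open>\<beta>\<close> control the smaller order
  \<open>e\<close>; the 1 covers small \<open>a\<close>.\<close>

lemma powr_le_one_plus_powr:
  fixes a e \<beta> :: real
  assumes "a \<ge> 0" "0 \<le> e" "e \<le> \<beta>"
  shows "a powr e \<le> 1 + a powr \<beta>"
proof (cases "a \<le> 1")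
  case True
  then have "a powr e \<le> 1" using assms by (intro powr_le1) auto
  then show ?thesis by (simp add: add_increasing2)
next
  case False
  then have "a powr e \<le> a powr \<beta>" using assms by (intro powr_mono) auto
  then show ?thesis by simp
qed

text \<open>After scaling by \<open>w\<close>, the cell has corner \<open>node t k\<close> and sides
  at most \<open>\<Delta>\<close>; the l1 norm bounds the distance to the corner, and the triangle
  inequality gives the rest.\<close>

lemma norm_node_box_le:
  fixes t :: "'n::finite \<Rightarrow> int \<Rightarrow> real" and \<Delta> :: real
  assumes "\<And>i j. t i (j + 1) - t i j \<le> \<Delta>" "w > 0" "u \<in> node_box t w k"
  shows "norm (u - x) \<le> (CARD('n) * \<Delta> + norm (w *\<^sub>R x - node t k)) / w"
proof -
  have "norm (w *\<^sub>R u - node t k) \<le> (\<Sum>i\<in>UNIV. \<bar>(w *\<^sub>R u - node t k) $ i\<bar>)" by (rule norm_le_l1_cart)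
  also have "\<dots> \<le> (\<Sum>i\<in>(UNIV :: 'n set). \<Delta>)"
  proof (rule sum_mono)
    fix i
    have "t i (k $ i) \<le> w * u $ i" "w * u $ i \<le> t i (k $ i + 1)"
      using assms(2,3) by (auto simp: node_box_def field_simps)
    then show "\<bar>(w *\<^sub>R u - node t k) $ i\<bar> \<le> \<Delta>" using assms(1)[of i "k $ i"] by (simp add: node_def)
  qed
  finally have "norm (w *\<^sub>R u - node t k) \<le> CARD('n) * \<Delta>" by simp
  then have "norm (w *\<^sub>R (u - x)) \<le> CARD('n) * \<Delta> + norm (w *\<^sub>R x - node t k)"
    using norm_triangle_ineq4[of "w *\<^sub>R u - node t k" "w *\<^sub>R x - node t k"]
    by (simp add: algebra_simps)
  then show ?thesis using assms(2) by (simp add: pos_le_divide_eq mult.commute)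
qed

text \<open>The Hoelder bound on the cell passes to the mean value. \<open>D\<close> is independent
  of \<open>w\<close>, \<open>x\<close> and \<open>k\<close>, so the estimate can be summed
  uniformly.\<close>

lemma kantorovich_term_close:
  fixes t :: "'n::finite \<Rightarrow> int \<Rightarrow> real" and chi f :: "real ^ 'n \<Rightarrow> real"
  assumes nodes: "sampling_nodes t" and cont: "continuous_on UNIV f"
    and holder: "L \<ge> 0" "\<And>x y. \<bar>f x - f y\<bar> \<le> L * norm (x - y) powr e"
    and e: "0 < e" "e \<le> \<beta>"
  obtains D where "D \<ge> 0"
    "\<And>w x k. w > 0 \<Longrightarrow> \<bar>kantorovich_term t chi w f x k - chi (w *\<^sub>R x - node t k) * f x\<bar>
       \<le> D * w powr - e * (\<bar>chi (w *\<^sub>R x - node t k)\<bar> * (1 + norm (w *\<^sub>R x - node t k) powr \<beta>))"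
proof -
  obtain \<Delta> where \<Delta>: "\<Delta> > 0" "\<And>i j. t i (j + 1) - t i j \<le> \<Delta>"
    using nodes unfolding sampling_nodes_def by blast
  \<comment> \<open>\<open>E\<close> comes from the size of the cell; in \<open>D\<close>, the
    factor \<open>2 powr e\<close> comes from \<open>powr_add_le\<close>.\<close>
  define E where "E = (CARD('n) * \<Delta>) powr e"
  define D where "D = L * 2 powr e * (E + 1)"
  have "E \<ge> 0" by (simp add: E_def)
  show thesis
  proof
    show "D \<ge> 0" using holder(1) \<open>E \<ge> 0\<close> by (simp add: D_def)
  next
    fix w :: real and x k assume w: "w > 0"
    let ?v = "norm (w *\<^sub>R x - node t k)" and ?R = "node_box t w k"
    let ?b = "D * w powr - e * (1 + ?v powr \<beta>)"
    have "\<bar>f u - f x\<bar> \<le> ?b" if "u \<in> ?R" for u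
    proof -
      have "norm (u - x) powr e \<le> ((CARD('n) * \<Delta> + ?v) / w) powr e"
        using norm_node_box_le[OF \<Delta>(2) w that] e by (intro powr_mono2) auto
      also have "\<dots> = (CARD('n) * \<Delta> + ?v) powr e * w powr - e"
        using w \<Delta>(1) by (simp add: powr_divide powr_minus_divide)
      also have "\<dots> \<le> (2 powr e * (E + ?v powr e)) * w powr - e"
        unfolding E_def using \<Delta> e by (intro mult_right_mono powr_add_le) auto
      also have "\<dots> \<le> (2 powr e * ((E + 1) * (1 + ?v powr \<beta>))) * w powr - e"
      proof (intro mult_right_mono mult_left_mono)
        \<comment> \<open>The left side is at most \<open>E + 1 + ?v powr \<beta>\<close>; the
          product on the right has the further nonnegative term
          \<open>E * ?v powr \<beta>\<close>.\<close>
        show "E + ?v powr e \<le> (E + 1) * (1 + ?v powr \<beta>)"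
          using powr_le_one_plus_powr[of ?v e \<beta>] e mult_nonneg_nonneg[OF \<open>E \<ge> 0\<close>, of "?v powr \<beta>"]
          by (simp add: algebra_simps)
      qed auto
      finally have "L * norm (u - x) powr e
          \<le> L * ((2 powr e * ((E + 1) * (1 + ?v powr \<beta>))) * w powr - e)"
        using holder(1) by (rule mult_left_mono)
      with holder(2)[of u x] show ?thesis by (simp add: D_def mult_ac)
    qed
    moreover have pos: "measure lebesgue ?R > 0"
      using w nodes node_volume_pos[OF nodes, of k] by (simp add: measure_node_box)
    moreover have "compact ?R" by (simp add: node_box_eq_cbox)
    ultimately have "\<bar>1 / measure lebesgue ?R * (LINT u:?R|lebesgue. f u) - f x\<bar> \<le> ?b"
      using pos by (intro mean_value_close set_integrable_lebesgue_continuous cont)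
        (auto simp: node_box_eq_cbox emeasure_lborel_cbox_eq)
    then have "\<bar>chi (w *\<^sub>R x - node t k)\<bar> * \<bar>w ^ CARD('n) / node_volume t k * (LINT u:?R|lebesgue. f u) - f x\<bar>
        \<le> \<bar>chi (w *\<^sub>R x - node t k)\<bar> * ?b"
      using w nodes by (intro mult_left_mono) (auto simp: measure_node_box)
    then show "\<bar>kantorovich_term t chi w f x k - chi (w *\<^sub>R x - node t k) * f x\<bar>
       \<le> D * w powr - e * (\<bar>chi (w *\<^sub>R x - node t k)\<bar> * (1 + ?v powr \<beta>))"
      unfolding kantorovich_term_def abs_mult[symmetric] right_diff_distrib by (simp add: mult_ac)
  qed
qed

section \<open>Summation of the error\<close>

theorem theorem4p1:
  fixes t :: "'n::finite \<Rightarrow> int \<Rightarrow> real"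
    and chi f :: "real ^ 'n \<Rightarrow> real"
    and \<mu> \<beta> \<nu> :: real
  assumes "sampling_nodes t"
    and "sampling_kernel t \<mu> \<beta> chi"
    and "0 < \<nu>" and "\<nu> \<le> 1"
    and "f \<in> Lip_infinity \<nu>"
  shows "(\<forall>w>0. kantorovich_defined t chi w f) \<and>
    sup_norm_bigo (\<lambda>w x. kantorovich t chi w f x - f x) (\<lambda>w. w powr - Min {\<nu>, \<beta>, \<mu>})"
proof -
  have "\<beta> > 0" and A: "sup_norm_bigo (\<lambda>w x. discrete_sum t chi w x - 1) (\<lambda>w. w powr - \<mu>)"
    using assms(2) unfolding sampling_kernel_def by auto
  have cont: "continuous_on UNIV f" and "bounded (range f)"
    using assms(5) by (auto simp: Lip_infinity_def uniformly_continuous_imp_continuous)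
  then obtain M where M: "M > 0" "\<And>x. \<bar>f x\<bar> \<le> M" unfolding bounded_pos by auto
  \<comment> \<open>\<open>e\<close> governs the termwise differences; \<open>\<mu>\<close> enters
    only through the factor \<open>discrete_sum - 1\<close>.\<close>
  define e where "e = min \<nu> \<beta>"
  define \<epsilon> where "\<epsilon> = Min {\<nu>, \<beta>, \<mu>}"
  have e: "0 < e" "e \<le> \<nu>" "e \<le> \<beta>" and \<epsilon>: "\<epsilon> \<le> e" "\<epsilon> \<le> \<mu>"
    using \<open>\<beta> > 0\<close> assms(3) by (auto simp: e_def \<epsilon>_def)
  obtain c where c: "c \<ge> 0"
    "\<And>u F. finite F \<Longrightarrow> (\<Sum>k\<in>F. \<bar>chi (u - node t k)\<bar> * (1 + norm (u - node t k) powr \<beta>)) \<le> c"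
    using kernel_weighted_sum_bounded[OF assms(1,2)] by blast
  obtain L where L: "L \<ge> 0" "\<And>x y. \<bar>f x - f y\<bar> \<le> L * norm (x - y) powr e"
    using Lip_infinity_global[OF assms(5) e(1,2)] by blast
  obtain D where D: "D \<ge> 0"
    "\<And>w x k. w > 0 \<Longrightarrow> \<bar>kantorovich_term t chi w f x k - chi (w *\<^sub>R x - node t k) * f x\<bar>
       \<le> D * w powr - e * (\<bar>chi (w *\<^sub>R x - node t k)\<bar> * (1 + norm (w *\<^sub>R x - node t k) powr \<beta>))"
    using kantorovich_term_close[OF assms(1) cont L e(1,3)] by blast
  \<comment> \<open>The weight \<open>1 + norm v powr \<beta>\<close> is at least 1, so the weighted
    kernel itself is a majorant.\<close>
  have chi_sum: "(\<lambda>k. chi (w *\<^sub>R x - node t k)) summable_on UNIV" for w x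
    by (rule abs_summable_on_of_bounded_sums(1)[where a = 1, OF _ _ c(2)[of _ "w *\<^sub>R x"]])
      (auto simp: algebra_simps)
  have diff_sum: "(\<lambda>k. kantorovich_term t chi w f x k - chi (w *\<^sub>R x - node t k) * f x) summable_on UNIV"
    and diff_le: "\<bar>\<Sum>\<^sub>\<infinity>k. kantorovich_term t chi w f x k - chi (w *\<^sub>R x - node t k) * f x\<bar>
      \<le> D * w powr - e * c" if "w > 0" for w x
    using abs_summable_on_of_bounded_sums[OF D(2)[OF that] _ c(2)] D(1) by auto
  have split: "kantorovich_term t chi w f x = (\<lambda>k.
      (kantorovich_term t chi w f x k - chi (w *\<^sub>R x - node t k) * f x) + chi (w *\<^sub>R x - node t k) * f x)" for w x
    by simp
  have chi_f_sum: "(\<lambda>k. chi (w *\<^sub>R x - node t k) * f x) summable_on UNIV" for w x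
    by (intro summable_on_cmult_left chi_sum)
  have term_sum: "kantorovich_term t chi w f x summable_on UNIV" if "w > 0" for w x
    by (subst split) (intro summable_on_add diff_sum that chi_f_sum)
  have err: "kantorovich t chi w f x - f x =
      (\<Sum>\<^sub>\<infinity>k. kantorovich_term t chi w f x k - chi (w *\<^sub>R x - node t k) * f x)
      + (discrete_sum t chi w x - 1) * f x" if "w > 0" for w x
    unfolding kantorovich_def discrete_sum_def
    by (subst split, subst infsum_add[OF diff_sum[OF that] chi_f_sum])
      (simp add: infsum_cmult_left' left_diff_distrib)
  obtain C where C: "C > 0"
    "\<forall>\<^sub>F w in at_top. sup_norm (\<lambda>x. discrete_sum t chi w x - 1) \<le> ennreal (C * \<bar>w powr - \<mu>\<bar>)"
    using A unfolding sup_norm_bigo_def by blast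
  have "\<forall>\<^sub>F w in at_top. sup_norm (\<lambda>x. kantorovich t chi w f x - f x)
      \<le> ennreal ((D * c + C * M) * \<bar>w powr - \<epsilon>\<bar>)"
    using C(2) eventually_ge_at_top[of 1]
  proof eventually_elim
    case (elim w)
    have "\<bar>kantorovich t chi w f x - f x\<bar> \<le> (D * c + C * M) * w powr - \<epsilon>" for x
    proof -
      have "\<bar>discrete_sum t chi w x - 1\<bar> \<le> C * w powr - \<mu>"
        using elim(1) C(1) by (simp add: sup_norm_le_iff)
      then have "\<bar>(discrete_sum t chi w x - 1) * f x\<bar> \<le> C * w powr - \<mu> * M"
        using M C(1) unfolding abs_mult by (intro mult_mono) auto
      then have "\<bar>kantorovich t chi w f x - f x\<bar> \<le> D * w powr - e * c + C * w powr - \<mu> * M"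
        using diff_le[of w x] elim(2) by (subst err) auto
      \<comment> \<open>Since \<open>w \<ge> 1\<close>, the smaller rate \<open>\<epsilon>\<close>
        dominates both \<open>e\<close> and \<open>\<mu>\<close>.\<close>
      also have "\<dots> \<le> D * w powr - \<epsilon> * c + C * w powr - \<epsilon> * M"
        using elim(2) \<epsilon> D(1) c(1) C(1) M(1)
        by (intro add_mono mult_left_mono mult_right_mono powr_mono) auto
      finally show ?thesis by (simp add: algebra_simps)
    qed
    then show ?case using D(1) c(1) C(1) M(1) by (simp add: sup_norm_le_iff)
  qed
  \<comment> \<open>The constant in \<open>sup_norm_bigo\<close> must be strictly positive;
    \<open>D * c\<close> may vanish, \<open>C * M\<close> cannot.\<close>
  moreover have "D * c + C * M > 0" using D(1) c(1) C(1) M(1) by (simp add: add_nonneg_pos)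
  ultimately show ?thesis
    unfolding kantorovich_defined_def sup_norm_bigo_def \<epsilon>_def
    using term_sum set_integrable_lebesgue_continuous[OF cont] by blast
qed

end
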